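(* Let $m,n$ be positive integers and let $N(m,n)$ be the number of all threshold functions $f:\{0,1,\dots,m\}\times\{0,1,\dots,n\}\to\{0,1\}$. Then $$N(m,n) = (2m+1)(2n+1) + 1 + 4V(m,n),$$ where $$V(m,n) = \sum_{\substack{1\le i\le m,\ 1\le j\le n\\ \gcd(i,j)=1}} (m+1-i)(n+1-j).$$
   Context: A function $f:\{0,1,\dots,m\}\times\{0,1,\dots,n\}\to\{0,1\}$ is a (two-dimensional) threshold function if there exist real numbers $a,b,c$ with $(a,b)\neq(0,0)$ (a line $ax+by+c=0$) such that for all $(x,y)$ in the domain, $f(x,y)=0 \iff ax+by+c\le 0$. *)

theory Defs
  imports Complex_Main "HOL-Library.FuncSet"
begin

definition grid :: "nat \<Rightarrow> nat \<Rightarrow> (nat \<times> nat) set" where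
  "grid m n = {0..m} \<times> {0..n}"

(* The extensional function space makes each function on the finite grid correspond to
   exactly one HOL function (undefined off the grid), so that counting is meaningful. *)
definition threshold_functions :: "nat \<Rightarrow> nat \<Rightarrow> (nat \<times> nat \<Rightarrow> nat) set" where
  "threshold_functions m n =
     {f \<in> grid m n \<rightarrow>\<^sub>E {0, 1}.
        \<exists>a b c :: real. (a, b) \<noteq> (0, 0) \<and>
          (\<forall>(x, y) \<in> grid m n. f (x, y) = 0 \<longleftrightarrow> a * real x + b * real y + c \<le> 0)}"

definition N :: "nat \<Rightarrow> nat \<Rightarrow> nat" where
  "N m n = card (threshold_functions m n)"

(* The subtractions never truncate: i \<le> m and j \<le> n on the index set. *)
definition V :: "nat \<Rightarrow> nat \<Rightarrow> nat" where
  "V m n = (\<Sum>(i, j) \<in> {(i, j). 1 \<le> i \<and> i \<le> m \<and> 1 \<le> j \<and> j \<le> n \<and> gcd i j = 1}.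
              (m + 1 - i) * (n + 1 - j))"

end

theory Submission
  imports Defs
begin

text \<open>
  A non-constant threshold function splits the grid into two non-empty separable parts \<open>S\<close> (value 0)
  and \<open>T\<close> (value 1). Among the two inner common tangents of their convex hulls, one has \<open>S\<close> on its left
  when it is directed from \<open>S\<close> to \<open>T\<close>; on it, let \<open>p\<close> be the last point of \<open>S\<close> and \<open>q\<close> the first point
  of \<open>T\<close>. No lattice point lies between them, so \<open>q - p\<close> is primitive. Conversely, any ordered pair of
  grid points with primitive difference arises in this way: turn the line through \<open>p\<close> and \<open>q\<close> slightly
  counterclockwise about a point between them. Hence the non-constant threshold functions correspond to the
  ordered pairs with primitive difference, and these are counted by their coordinate differences.
\<close>

section \<open>Lattice vectors and the cut given by an ordered pair of grid points\<close>

definition vec :: "nat \<times> nat \<Rightarrow> nat \<times> nat \<Rightarrow> int \<times> int" where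
  "vec p q = (int (fst q) - int (fst p), int (snd q) - int (snd p))"

definition cross :: "int \<times> int \<Rightarrow> int \<times> int \<Rightarrow> int" where
  "cross u v = fst u * snd v - snd u * fst v"

definition dot :: "int \<times> int \<Rightarrow> int \<times> int \<Rightarrow> int" where
  "dot u v = fst u * fst v + snd u * snd v"

definition primitive :: "int \<times> int \<Rightarrow> bool" where
  "primitive u \<longleftrightarrow> coprime (fst u) (snd u)"

definition scale :: "int \<Rightarrow> int \<times> int \<Rightarrow> int \<times> int" where
  "scale k u = (k * fst u, k * snd u)"

text \<open>The open half-plane to the left of the line directed from \<open>p\<close> to
  \<open>q\<close>, together with the closed ray of that line that ends at \<open>p\<close>. The ray
  records on which side the points of the line fall after a small counterclockwise turn.\<close>

definition left_part :: "nat \<times> nat \<Rightarrow> nat \<times> nat \<Rightarrow> (nat \<times> nat) set" where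
  "left_part p q = {r. cross (vec p q) (vec p r) > 0 \<or>
     (cross (vec p q) (vec p r) = 0 \<and> dot (vec p q) (vec p r) \<le> 0)}"

definition pair_cut :: "nat \<Rightarrow> nat \<Rightarrow> (nat \<times> nat) \<times> (nat \<times> nat) \<Rightarrow> nat \<times> nat \<Rightarrow> nat" where
  "pair_cut m n = (\<lambda>(p, q). \<lambda>r\<in>grid m n. if r \<in> left_part p q then 0 else 1)"

definition primitive_pairs :: "nat \<Rightarrow> nat \<Rightarrow> ((nat \<times> nat) \<times> (nat \<times> nat)) set" where
  "primitive_pairs m n = {(p, q) \<in> grid m n \<times> grid m n. primitive (vec p q)}"

lemma finite_grid: "finite (grid m n)"
  by (simp add: grid_def)

text \<open>Since \<open>fst u\<close> divides \<open>snd u * fst v\<close> and is coprime to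
  \<open>snd u\<close>, it divides \<open>fst v\<close>, and the quotient is the scalar. If
  \<open>fst u = 0\<close>, then \<open>snd u\<close> is a unit and gives the scalar
  instead.\<close>

lemma primitive_parallel:
  assumes "primitive u" "cross u v = 0"
  obtains k where "v = scale k u"
proof -
  have eq: "fst u * snd v = snd u * fst v"
    using assms(2) by (simp add: cross_def)
  then have "fst u dvd snd u * fst v"
    by (metis dvd_triv_left)
  then have "fst u dvd fst v"
    using assms(1) by (simp add: primitive_def coprime_dvd_mult_right_iff)
  then obtain k where k: "fst v = fst u * k" ..
  show thesis
  proof (cases "fst u = 0")
    case True
    then have "is_unit (snd u)"
      using assms(1) by (simp add: primitive_def)
    then have "snd u dvd snd v"
      by (rule unit_imp_dvd)
    then obtain l where "snd v = snd u * l" ..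
    then have "v = scale l u"
      using True k by (simp add: scale_def prod_eq_iff mult.commute)
    then show thesis by (rule that)
  next
    case False
    have "fst u * snd v = fst u * (snd u * k)"
      using eq k by (simp add: algebra_simps)
    then have "snd v = snd u * k" using False by simp
    then have "v = scale k u"
      using k by (simp add: scale_def prod_eq_iff mult.commute)
    then show thesis by (rule that)
  qed
qed

lemma dot_self_pos: "u \<noteq> (0, 0) \<Longrightarrow> dot u u > 0"
  by (cases u) (auto simp: dot_def sum_squares_gt_zero_iff)

lemma primitive_nonzero: "primitive u \<Longrightarrow> u \<noteq> (0, 0)"
  by (auto simp: primitive_def)

lemma dot_scale: "dot u (scale k u) = k * dot u u"
  by (simp add: dot_def scale_def algebra_simps)

lemma left_part_endpoints:
  assumes "vec p q \<noteq> (0, 0)"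
  shows "p \<in> left_part p q" "q \<notin> left_part p q"
  using dot_self_pos[OF assms]
  by (auto simp: left_part_def cross_def dot_def vec_def)

lemma cut_zero_iff: "r \<in> grid m n \<Longrightarrow> pair_cut m n (p, q) r = 0 \<longleftrightarrow> r \<in> left_part p q"
  by (simp add: pair_cut_def)

lemma cut_in_PiE: "pair_cut m n pq \<in> grid m n \<rightarrow>\<^sub>E {0, 1}"
  by (auto simp: pair_cut_def split: prod.splits)

text \<open>The functional \<open>dot - M cross\<close> is the line through \<open>p\<close> and \<open>q\<close> turned by a small angle; since
  \<open>cross\<close> is an integer, it suffices that \<open>M\<close> exceeds all values of \<open>dot\<close> on the grid.\<close>

lemma cut_threshold:
  assumes "p \<in> grid m n" "q \<in> grid m n" "vec p q \<noteq> (0, 0)"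
  shows "pair_cut m n (p, q) \<in> threshold_functions m n"
proof -
  let ?d = "vec p q"
  obtain M :: int where M: "\<And>r. r \<in> grid m n \<Longrightarrow> \<bar>dot ?d (vec p r)\<bar> < M"
  proof
    fix r assume "r \<in> grid m n"
    then have "\<bar>dot ?d (vec p r)\<bar> \<le> Max ((\<lambda>r. \<bar>dot ?d (vec p r)\<bar>) ` grid m n)"
      by (intro Max_ge) (auto simp: finite_grid)
    then show "\<bar>dot ?d (vec p r)\<bar> < Max ((\<lambda>r. \<bar>dot ?d (vec p r)\<bar>) ` grid m n) + 1"
      by simp
  qed
  define F where "F r = dot ?d (vec p r) - M * cross ?d (vec p r)" for r
  have sign: "r \<in> left_part p q \<longleftrightarrow> F r \<le> 0" if "r \<in> grid m n" for r
  proof -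
    note b = M[OF that]
    consider "cross ?d (vec p r) \<ge> 1" | "cross ?d (vec p r) = 0" | "cross ?d (vec p r) \<le> - 1"
      by linarith
    then show ?thesis
    proof cases
      case 1
      then have "M * 1 \<le> M * cross ?d (vec p r)"
        using b by (intro mult_left_mono) auto
      then show ?thesis using 1 b by (auto simp: left_part_def F_def)
    next
      case 2
      then show ?thesis by (auto simp: left_part_def F_def)
    next
      case 3
      then have "M * cross ?d (vec p r) \<le> M * (- 1)"
        using b by (intro mult_left_mono) auto
      then show ?thesis using 3 b by (auto simp: left_part_def F_def)
    qed
  qed
  define a b where "a = fst ?d + M * snd ?d" and "b = snd ?d - M * fst ?d"
  define c where "c = - a * int (fst p) - b * int (snd p)"
  have F: "F (x, y) = a * int x + b * int y + c" for x y
    by (simp add: F_def a_def b_def c_def dot_def cross_def vec_def algebra_simps)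
  \<comment> \<open>The linear part of \<open>F\<close> takes the positive value \<open>F q\<close>
    on the vector from \<open>p\<close> to \<open>q\<close>, so its coefficients cannot both
    vanish.\<close>
  have "F q = dot ?d ?d" by (simp add: F_def cross_def mult.commute)
  then have "F q > 0" using dot_self_pos[OF assms(3)] by simp
  moreover have "F q = a * fst ?d + b * snd ?d"
    using F[of "fst q" "snd q"] by (simp add: c_def vec_def algebra_simps)
  ultimately have ab: "(a, b) \<noteq> (0, 0)" by auto
  have "pair_cut m n (p, q) (x, y) = 0 \<longleftrightarrow>
      real_of_int a * real x + real_of_int b * real y + real_of_int c \<le> 0"
    if "(x, y) \<in> grid m n" for x y
  proof -
    have "pair_cut m n (p, q) (x, y) = 0 \<longleftrightarrow> real_of_int (F (x, y)) \<le> 0"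
      using that by (simp add: cut_zero_iff sign)
    then show ?thesis by (simp add: F)
  qed
  moreover have "(real_of_int a, real_of_int b) \<noteq> (0, 0)" using ab by simp
  ultimately show ?thesis
    unfolding threshold_functions_def using cut_in_PiE by blast
qed

section \<open>Uniqueness of the primitive pair behind a cut\<close>

lemma cross_vec_diff: "cross u (vec p r) - cross u (vec p s) = cross u (vec s r)"
  by (simp add: cross_def vec_def algebra_simps)

text \<open>Each pair is separated by the cut of the other. This forces both onto one line with the
  same direction; primitivity then makes the vectors equal, and comparing the positions of
  \<open>p\<close> and \<open>p'\<close> finishes the proof.\<close>

lemma cut_inj: "inj_on (pair_cut m n) (primitive_pairs m n)"
proof (rule inj_onI, clarsimp)
  fix px py qx qy px' py' qx' qy' :: nat
  define p q p' q' where defs: "p = (px, py)" "q = (qx, qy)" "p' = (px', py')" "q' = (qx', qy')"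
  assume "((px, py), (qx, qy)) \<in> primitive_pairs m n"
    and "((px', py'), (qx', qy')) \<in> primitive_pairs m n"
    and "pair_cut m n ((px, py), (qx, qy)) = pair_cut m n ((px', py'), (qx', qy'))"
  then have prim: "primitive (vec p q)" "primitive (vec p' q')"
    and grid: "p \<in> grid m n" "q \<in> grid m n" "p' \<in> grid m n" "q' \<in> grid m n"
    and eq: "pair_cut m n (p, q) = pair_cut m n (p', q')"
    unfolding defs by (auto simp: primitive_pairs_def)
  let ?d = "vec p q" and ?d' = "vec p' q'"
  have same: "r \<in> left_part p q \<longleftrightarrow> r \<in> left_part p' q'" if "r \<in> grid m n" for r
    using eq that by (metis cut_zero_iff)
  have mem: "p' \<in> left_part p q" "q' \<notin> left_part p q" "p \<in> left_part p' q'" "q \<notin> left_part p' q'"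
    using left_part_endpoints prim[THEN primitive_nonzero] same grid by blast+
  have "cross ?d (vec p p') \<ge> 0" "cross ?d (vec p q') \<le> 0"
    "cross ?d' (vec p' p) \<ge> 0" "cross ?d' (vec p' q) \<le> 0"
    using mem by (auto simp: left_part_def)
  \<comment> \<open>The first identity gives \<open>cross ?d ?d' \<le> 0\<close>, the second gives
    the reverse inequality. So both differences vanish, and with them all four of the signed terms
    above.\<close>
  moreover have "cross ?d (vec p q') - cross ?d (vec p p') = cross ?d ?d'"
    "cross ?d' (vec p' q) - cross ?d' (vec p' p) = - cross ?d ?d'"
    by (simp_all add: cross_def vec_def algebra_simps)
  ultimately have zero: "cross ?d ?d' = 0" "cross ?d (vec p p') = 0" "cross ?d (vec p q') = 0"
    "cross ?d' (vec p' p) = 0"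
    by linarith+
  then have dots: "dot ?d (vec p p') \<le> 0" "dot ?d (vec p q') > 0" "dot ?d' (vec p' p) \<le> 0"
    using mem by (auto simp: left_part_def)
  have pos: "dot ?d ?d > 0" using prim(1) by (intro dot_self_pos primitive_nonzero)
  obtain k where k: "?d' = scale k ?d"
    using primitive_parallel[OF prim(1) zero(1)] .
  obtain t where t: "vec p p' = scale t ?d"
    using primitive_parallel[OF prim(1) zero(2)] .
  have "dot ?d (vec p q') - dot ?d (vec p p') = dot ?d ?d'"
    by (simp add: dot_def vec_def algebra_simps)
  \<comment> \<open>\<open>p'\<close> is not ahead of \<open>p\<close> while \<open>q'\<close> is,
    so \<open>k\<close> is positive. As a common divisor of the coordinates of a primitive vector it
    is a unit, hence 1.\<close>
  then have "k * dot ?d ?d > 0" using dots k by (simp add: dot_scale)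
  then have "k > 0" using pos by (simp add: zero_less_mult_iff)
  moreover have "k dvd fst ?d'" "k dvd snd ?d'" using k by (simp_all add: scale_def)
  then have "is_unit k" using prim(2) unfolding primitive_def by (meson coprime_common_divisor)
  ultimately have dd: "?d' = ?d" using k by (simp add: scale_def)
  have "dot ?d' (vec p' p) = - dot ?d (vec p p')"
    unfolding dd by (simp add: dot_def vec_def algebra_simps)
  then have "dot ?d (vec p p') = 0" using dots by simp
  then have "t = 0" using t pos by (simp add: dot_scale)
  then have "p' = p" using t by (auto simp: scale_def vec_def prod_eq_iff)
  moreover have "q' = q" using dd calculation by (auto simp: vec_def prod_eq_iff)
  ultimately show "px = px' \<and> py = py' \<and> qx = qx' \<and> qy = qy'"
    by (simp add: defs)
qed

section \<open>The inner common tangent of two separated finite sets\<close>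

text \<open>A change to the orthogonal coordinates along \<open>(a, b)\<close> and
  \<open>(-b, a)\<close>, which multiplies determinants by \<open>a * a + b * b\<close>.\<close>

lemma cross_dot_real:
  fixes a b :: real
  shows "(a * a + b * b) * real_of_int (cross u v) =
    (a * fst u + b * snd u) * (a * snd v - b * fst v) - (a * snd u - b * fst u) * (a * fst v + b * snd v)"
  by (simp add: cross_def algebra_simps)

text \<open>All vectors from \<open>S\<close> to \<open>T\<close> lie in one open half-plane, so the
  sign of \<open>cross\<close> compares their slopes relative to \<open>(a, b)\<close>. A pair of
  greatest slope spans the tangent; among those, one with the least component along
  \<open>(a, b)\<close> is chosen.\<close>

lemma extreme_pair:
  fixes a b :: real
  assumes fin: "finite S" "finite T" and ne: "S \<noteq> {}" "T \<noteq> {}"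
    and pos: "\<And>p q. p \<in> S \<Longrightarrow> q \<in> T \<Longrightarrow> a * fst (vec p q) + b * snd (vec p q) > 0"
  obtains p q where "p \<in> S" "q \<in> T"
    "\<And>p' q'. p' \<in> S \<Longrightarrow> q' \<in> T \<Longrightarrow> cross (vec p q) (vec p' q') \<le> 0"
    "\<And>p' q'. p' \<in> S \<Longrightarrow> q' \<in> T \<Longrightarrow> cross (vec p q) (vec p' q') = 0 \<Longrightarrow>
       a * fst (vec p q) + b * snd (vec p q) \<le> a * fst (vec p' q') + b * snd (vec p' q')"
proof -
  define U where "U z = (case z of (p, q) \<Rightarrow> a * fst (vec p q) + b * snd (vec p q))" for z
  define W where "W z = (case z of (p, q) \<Rightarrow> a * snd (vec p q) - b * fst (vec p q))" for z
  define C where "C z z' = (case z of (p, q) \<Rightarrow> case z' of (p', q') \<Rightarrow> cross (vec p q) (vec p' q'))" for z z'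
  let ?D = "S \<times> T"
  have U: "U z > 0" if "z \<in> ?D" for z
    using that pos by (auto simp: U_def)
  obtain z0 where "z0 \<in> ?D" using ne by auto
  \<comment> \<open>A single pair suffices: the functional is positive there, so
    \<open>(a, b)\<close> is nonzero.\<close>
  then have ab: "a * a + b * b > 0"
    using U[of z0] by (cases "a = 0 \<and> b = 0") (auto simp: U_def sum_squares_gt_zero_iff)
  have id: "(a * a + b * b) * of_int (C z z') = U z * W z' - W z * U z'" for z z'
    by (cases z; cases z') (simp add: C_def U_def W_def cross_dot_real)
  have C: "C z z' \<le> 0 \<longleftrightarrow> W z' / U z' \<le> W z / U z" "C z z' = 0 \<longleftrightarrow> W z' / U z' = W z / U z"
    if "z \<in> ?D" "z' \<in> ?D" for z z'
  proof -
    have "C z z' \<le> 0 \<longleftrightarrow> (a * a + b * b) * real_of_int (C z z') \<le> 0"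
      using ab by (simp add: mult_le_0_iff not_le)
    then show "C z z' \<le> 0 \<longleftrightarrow> W z' / U z' \<le> W z / U z"
      unfolding id using U[OF that(1)] U[OF that(2)] by (simp add: field_simps)
    have "C z z' = 0 \<longleftrightarrow> (a * a + b * b) * real_of_int (C z z') = 0"
      using ab by (metis mult_eq_0_iff of_int_eq_0_iff less_irrefl)
    then show "C z z' = 0 \<longleftrightarrow> W z' / U z' = W z / U z"
      unfolding id using U[OF that(1)] U[OF that(2)] by (auto simp: field_simps)
  qed
  have finD: "finite ?D" and neD: "?D \<noteq> {}" using fin ne by auto
  define s where "s = Max ((\<lambda>z. W z / U z) ` ?D)"
  define E where "E = {z \<in> ?D. W z / U z = s}"
  have "s \<in> (\<lambda>z. W z / U z) ` ?D"
    unfolding s_def using finD neD by (intro Max_in) auto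
  then have "E \<noteq> {}" by (auto simp: E_def)
  moreover have "finite E" unfolding E_def using finD by simp
  ultimately obtain z where z: "z \<in> E" "\<And>z'. z' \<in> E \<Longrightarrow> U z \<le> U z'"
    by (metis ex_min_if_finite leI arg_min_least arg_min_if_finite(1))
  have s: "W z' / U z' \<le> s" if "z' \<in> ?D" for z'
    unfolding s_def using finD that by (intro Max_ge) auto
  have zD: "z \<in> ?D" and zs: "W z / U z = s" using z(1) by (auto simp: E_def)
  obtain p q where pq: "z = (p, q)" by (cases z)
  show thesis
  proof (rule that)
    show "p \<in> S" "q \<in> T" using zD pq by auto
  next
    fix p' q' assume "p' \<in> S" "q' \<in> T"
    then have D: "(p', q') \<in> ?D" by simp
    have "C z (p', q') \<le> 0" using C(1)[OF zD D] s[OF D] zs by simp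
    then show "cross (vec p q) (vec p' q') \<le> 0" by (simp add: C_def pq)
    assume "cross (vec p q) (vec p' q') = 0"
    then have "C z (p', q') = 0" by (simp add: C_def pq)
    then have "(p', q') \<in> E" using C(2)[OF zD D] zs D by (simp add: E_def)
    from z(2)[OF this]
    show "a * fst (vec p q) + b * snd (vec p q) \<le> a * fst (vec p' q') + b * snd (vec p' q')"
      by (simp add: U_def pq)
  qed
qed

section \<open>Every non-constant threshold function is a cut\<close>

text \<open>Convexity: \<open>x + e\<close> lies between \<open>x\<close> and
  \<open>x + g * e\<close>. Applied to each coordinate, this keeps a lattice point of a segment
  inside the grid.\<close>

lemma scaled_between:
  fixes x e :: int
  assumes "g \<ge> 1" "0 \<le> x" "x \<le> M" "0 \<le> x + g * e" "x + g * e \<le> M"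
  shows "0 \<le> x + e \<and> x + e \<le> M"
proof (cases "e \<ge> 0")
  case True
  then have "1 * e \<le> g * e" using assms(1) by (intro mult_right_mono)
  then show ?thesis using True assms by linarith
next
  case False
  then have "g * e \<le> 1 * e" using assms(1) by (intro mult_right_mono_neg) auto
  then show ?thesis using False assms by linarith
qed

text \<open>With \<open>g\<close> the gcd of the coordinates, \<open>r\<close> is the lattice point
  next to \<open>p\<close> on the segment towards \<open>q\<close>.\<close>

lemma nonprimitive_subdivide:
  assumes "p \<in> grid m n" "q \<in> grid m n" "vec p q \<noteq> (0, 0)" "\<not> primitive (vec p q)"
  obtains r e g where "r \<in> grid m n" "g > 1" "vec p q = scale g e" "vec p r = e" "vec r q = scale (g - 1) e"
proof -
  define g where "g = gcd (fst (vec p q)) (snd (vec p q))"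
  have "g \<noteq> 0" using assms(3) by (auto simp: g_def prod_eq_iff)
  moreover have "g \<noteq> 1" using assms(4) by (auto simp: g_def primitive_def coprime_iff_gcd_eq_1)
  moreover have "g \<ge> 0" by (simp add: g_def)
  ultimately have g: "g > 1" by linarith
  have "g dvd fst (vec p q)" "g dvd snd (vec p q)" by (simp_all add: g_def)
  then obtain ex ey where e: "fst (vec p q) = g * ex" "snd (vec p q) = g * ey"
    by (auto elim!: dvdE)
  have qx: "int (fst q) = int (fst p) + g * ex" and qy: "int (snd q) = int (snd p) + g * ey"
    using e by (auto simp: vec_def)
  have bounds: "fst p \<le> m" "fst q \<le> m" "snd p \<le> n" "snd q \<le> n"
    using assms(1,2) by (auto simp: grid_def)
  have x: "0 \<le> int (fst p) + ex \<and> int (fst p) + ex \<le> int m"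
    by (rule scaled_between[of g]) (use g bounds qx in linarith)+
  have y: "0 \<le> int (snd p) + ey \<and> int (snd p) + ey \<le> int n"
    by (rule scaled_between[of g]) (use g bounds qy in linarith)+
  define r where "r = (nat (int (fst p) + ex), nat (int (snd p) + ey))"
  have "r \<in> grid m n" using x y by (auto simp: r_def grid_def)
  moreover have "vec p q = scale g (ex, ey)" using e by (simp add: scale_def prod_eq_iff)
  moreover have "vec p r = (ex, ey)" using x y by (simp add: r_def vec_def)
  moreover have "vec r q = scale (g - 1) (ex, ey)"
    using x y qx qy by (simp add: r_def vec_def scale_def algebra_simps)
  ultimately show thesis using g that by blast
qed

text \<open>The points \<open>z0\<close> and \<open>z1\<close> make both parts non-empty, so an
  extreme pair exists. Its minimality gives primitivity; its tangency decides the points off the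
  line, and the separating functional \<open>u\<close> those on it.\<close>

lemma cut_surj:
  assumes f: "f \<in> threshold_functions m n"
    and zero: "z0 \<in> grid m n" "f z0 = 0" and one: "z1 \<in> grid m n" "f z1 \<noteq> 0"
  shows "f \<in> pair_cut m n ` primitive_pairs m n"
proof -
  obtain a b c :: real where fPi: "f \<in> grid m n \<rightarrow>\<^sub>E {0, 1}"
    and abc: "\<forall>(x, y) \<in> grid m n. f (x, y) = 0 \<longleftrightarrow> a * real x + b * real y + c \<le> 0"
    using f unfolding threshold_functions_def by blast
  define S where "S = {r \<in> grid m n. f r = 0}"
  define T where "T = {r \<in> grid m n. f r \<noteq> 0}"
  have fin: "finite S" "finite T" by (auto simp: S_def T_def finite_grid)
  have ne: "S \<noteq> {}" "T \<noteq> {}" using zero one unfolding S_def T_def by blast+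
  define u where "u d = a * fst d + b * snd d" for d :: "int \<times> int"
  have pos: "u (vec p q) > 0" if "p \<in> S" "q \<in> T" for p q
  proof -
    have "a * real (fst p) + b * real (snd p) + c \<le> 0" "a * real (fst q) + b * real (snd q) + c > 0"
      using that abc by (auto simp: S_def T_def)
    then show ?thesis by (simp add: u_def vec_def algebra_simps)
  qed
  have u_scale: "u (scale k d) = k * u d" for k d
    by (simp add: u_def scale_def algebra_simps)
  obtain p q where pq: "p \<in> S" "q \<in> T"
    and extr: "\<And>p' q'. p' \<in> S \<Longrightarrow> q' \<in> T \<Longrightarrow> cross (vec p q) (vec p' q') \<le> 0"
    and least: "\<And>p' q'. p' \<in> S \<Longrightarrow> q' \<in> T \<Longrightarrow> cross (vec p q) (vec p' q') = 0 \<Longrightarrow>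
       u (vec p q) \<le> u (vec p' q')"
    using extreme_pair[OF fin ne, of a b] pos unfolding u_def by metis
  let ?d = "vec p q"
  have pqG: "p \<in> grid m n" "q \<in> grid m n" using pq by (auto simp: S_def T_def)
  have d0: "?d \<noteq> (0, 0)" using pos[OF pq] by (auto simp: u_def)
  have prim: "primitive ?d"
  proof (rule ccontr)
    assume "\<not> primitive ?d"
    then obtain r e g where r: "r \<in> grid m n" "g > 1" "?d = scale g e"
      "vec p r = e" "vec r q = scale (g - 1) e"
      using nonprimitive_subdivide pqG d0 by metis
    have "real_of_int g * u e > 0" using pos[OF pq] r(3) by (simp add: u_scale)
    then have ue: "u e > 0" using r(2) by (simp add: zero_less_mult_iff)
    \<comment> \<open>Whichever part contains \<open>r\<close>, one of the pairs
      \<open>(r, q)\<close> and \<open>(p, r)\<close> goes from \<open>S\<close> to \<open>T\<close>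
      along the same line with a smaller value of \<open>u\<close>, against the choice of
      \<open>(p, q)\<close>.\<close>
    show False
    proof (cases "r \<in> S")
      case True
      then have "u ?d \<le> u (vec r q)"
        by (rule least[OF _ pq(2)]) (simp add: r cross_def scale_def)
      then show False using ue r by (simp add: u_scale algebra_simps)
    next
      case False
      then have "r \<in> T" using r(1) by (simp add: S_def T_def)
      then have "u ?d \<le> u (vec p r)"
        by (rule least[OF pq(1)]) (simp add: r cross_def scale_def)
      then have "real_of_int g * u e \<le> 1 * u e" using r by (simp add: u_scale)
      then show False using ue r(2) by (simp add: mult_le_cancel_right)
    qed
  qed
  have inS: "r \<in> left_part p q" if r: "r \<in> S" for r
  proof -
    \<comment> \<open>Tangency speaks of vectors ending at \<open>q\<close>; as \<open>q\<close>
      lies on the line, moving the base point to \<open>p\<close> only changes the sign.\<close>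
    have "cross ?d (vec r q) = - cross ?d (vec p r)"
      using cross_vec_diff[of ?d p q r] by (simp add: cross_def mult.commute)
    then have "cross ?d (vec p r) \<ge> 0" using extr[OF r pq(2)] by simp
    \<comment> \<open>Here \<open>r\<close> is \<open>p\<close> shifted by \<open>t\<close> times
      \<open>?d\<close>. Separation from \<open>q\<close> yields only \<open>t < 1\<close>;
      primitivity makes \<open>t\<close> an integer, so \<open>t \<le> 0\<close>.\<close>
    moreover have "dot ?d (vec p r) \<le> 0" if zero: "cross ?d (vec p r) = 0"
    proof -
      obtain t where t: "vec p r = scale t ?d" using primitive_parallel[OF prim zero] .
      have "u (vec r q) = u ?d - u (vec p r)" by (simp add: u_def vec_def algebra_simps)
      then have "u (vec r q) = (1 - t) * u ?d" using t by (simp add: u_scale algebra_simps)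
      then have "(1 - real_of_int t) * u ?d > 0" using pos[OF r pq(2)] by simp
      then have "t \<le> 0" using pos[OF pq] by (simp add: zero_less_mult_iff)
      then show ?thesis unfolding t dot_scale
        using dot_self_pos[OF d0] by (simp add: mult_le_0_iff)
    qed
    ultimately show ?thesis by (auto simp: left_part_def)
  qed
  have inT: "r \<notin> left_part p q" if r: "r \<in> T" for r
  proof -
    have "cross ?d (vec p r) \<le> 0" using extr[OF pq(1) r] .
    moreover have "dot ?d (vec p r) > 0" if zero: "cross ?d (vec p r) = 0"
    proof -
      obtain t where t: "vec p r = scale t ?d" using primitive_parallel[OF prim zero] .
      have "real_of_int t * u ?d > 0" using pos[OF pq(1) r] t by (simp add: u_scale)
      then have "t > 0" using pos[OF pq] by (simp add: zero_less_mult_iff)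
      then show ?thesis unfolding t dot_scale using dot_self_pos[OF d0] by simp
    qed
    ultimately show ?thesis by (auto simp: left_part_def)
  qed
  have "f r = pair_cut m n (p, q) r" for r
  proof (cases "r \<in> grid m n")
    case True
    then have "f r \<in> {0, 1}" using fPi by blast
    then show ?thesis
      using True inS[of r] inT[of r] by (auto simp: pair_cut_def S_def T_def)
  next
    case False
    then show ?thesis using PiE_arb[OF fPi False] by (simp add: pair_cut_def)
  qed
  then have "f = pair_cut m n (p, q)" by blast
  moreover have "(p, q) \<in> primitive_pairs m n"
    using pqG prim by (simp add: primitive_pairs_def)
  ultimately show ?thesis by blast
qed

section \<open>Classification into cuts and the two constants\<close>

lemma threshold_functions_eq:
  "threshold_functions m n =
    pair_cut m n ` primitive_pairs m n \<union> {\<lambda>r\<in>grid m n. 0, \<lambda>r\<in>grid m n. 1}"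
proof (intro equalityI subsetI)
  fix f assume f: "f \<in> threshold_functions m n"
  then have fPi: "f \<in> grid m n \<rightarrow>\<^sub>E {0, 1}" by (simp add: threshold_functions_def)
  consider "\<forall>r\<in>grid m n. f r = 0" | "\<forall>r\<in>grid m n. f r = 1"
    | z0 z1 where "z0 \<in> grid m n" "f z0 = 0" "z1 \<in> grid m n" "f z1 \<noteq> 0"
    using fPi by (metis PiE_mem insertE singletonD)
  then show "f \<in> pair_cut m n ` primitive_pairs m n \<union> {\<lambda>r\<in>grid m n. 0, \<lambda>r\<in>grid m n. 1}"
  proof cases
    case 1
    then have "f = (\<lambda>r\<in>grid m n. 0)" using fPi by (auto simp: PiE_def extensional_def fun_eq_iff)
    then show ?thesis by simp
  next
    case 2
    then have "f = (\<lambda>r\<in>grid m n. 1)" using fPi by (auto simp: PiE_def extensional_def fun_eq_iff)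
    then show ?thesis by simp
  next
    case 3
    then show ?thesis using cut_surj[OF f] by blast
  qed
next
  fix f assume "f \<in> pair_cut m n ` primitive_pairs m n \<union> {\<lambda>r\<in>grid m n. 0, \<lambda>r\<in>grid m n. 1}"
  then consider "f \<in> pair_cut m n ` primitive_pairs m n" | "f = (\<lambda>r\<in>grid m n. 0)" | "f = (\<lambda>r\<in>grid m n. 1)"
    by blast
  then show "f \<in> threshold_functions m n"
  proof cases
    case 1
    then obtain p q where "f = pair_cut m n (p, q)" "p \<in> grid m n" "q \<in> grid m n" "primitive (vec p q)"
      unfolding primitive_pairs_def by fast
    then show ?thesis using cut_threshold primitive_nonzero by blast
  next
    case 2
    \<comment> \<open>The coefficients \<open>(a, b)\<close> must not vanish, so the constants also
      need genuine lines: \<open>x = m\<close> has the whole grid on its closed zero side, and below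
      \<open>x = -1\<close> has none of it.\<close>
    have "\<forall>(x, y) \<in> grid m n. f (x, y) = 0 \<longleftrightarrow> (1::real) * real x + 0 * real y + (- real m) \<le> 0"
      using 2 by (auto simp: grid_def)
    moreover have "f \<in> grid m n \<rightarrow>\<^sub>E {0, 1}" using 2 by auto
    moreover have "(1::real, 0::real) \<noteq> (0, 0)" by simp
    ultimately show ?thesis unfolding threshold_functions_def by blast
  next
    case 3
    have "\<forall>(x, y) \<in> grid m n. f (x, y) = 0 \<longleftrightarrow> (1::real) * real x + 0 * real y + 1 \<le> 0"
      using 3 by (auto simp: grid_def)
    moreover have "f \<in> grid m n \<rightarrow>\<^sub>E {0, 1}" using 3 by auto
    moreover have "(1::real, 0::real) \<noteq> (0, 0)" by simp
    ultimately show ?thesis unfolding threshold_functions_def by blast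
  qed
qed

lemma finite_primitive_pairs: "finite (primitive_pairs m n)"
  by (rule finite_subset[of _ "grid m n \<times> grid m n"]) (auto simp: primitive_pairs_def finite_grid)

text \<open>The summand 2 counts the constants. They are no cuts, because a cut vanishes at
  \<open>p\<close> but not at \<open>q\<close>.\<close>

lemma N_eq_card_primitive_pairs: "N m n = card (primitive_pairs m n) + 2"
proof -
  let ?z = "\<lambda>r\<in>grid m n. 0 :: nat" and ?o = "\<lambda>r\<in>grid m n. 1 :: nat"
  have g: "(0, 0) \<in> grid m n" by (simp add: grid_def)
  have "?z (0, 0) \<noteq> ?o (0, 0)" using g by simp
  then have "?z \<noteq> ?o" by metis
  have const: "\<not> (\<exists>k. \<forall>r\<in>grid m n. f r = k)" if im: "f \<in> pair_cut m n ` primitive_pairs m n" for f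
  proof -
    obtain p q where f: "f = pair_cut m n (p, q)" and pq: "p \<in> grid m n" "q \<in> grid m n" "primitive (vec p q)"
      using im unfolding primitive_pairs_def by fast
    have "f p = 0" "f q \<noteq> 0"
      using left_part_endpoints[OF primitive_nonzero[OF pq(3)]] pq by (simp_all add: f cut_zero_iff)
    then show ?thesis using pq by metis
  qed
  have "\<forall>r\<in>grid m n. ?z r = 0" "\<forall>r\<in>grid m n. ?o r = 1" by simp_all
  then have "?z \<notin> pair_cut m n ` primitive_pairs m n" "?o \<notin> pair_cut m n ` primitive_pairs m n"
    using const[of ?z] const[of ?o] by metis+
  then have "pair_cut m n ` primitive_pairs m n \<inter> {?z, ?o} = {}"
    by (simp only: Int_insert_right if_False Int_empty_right)
  then have "N m n = card (pair_cut m n ` primitive_pairs m n) + card {?z, ?o}"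
    unfolding N_def threshold_functions_eq
    by (intro card_Un_disjoint) (auto simp: finite_primitive_pairs)
  then show ?thesis using \<open>?z \<noteq> ?o\<close> by (simp add: card_image cut_inj)
qed

section \<open>Counting primitive pairs by coordinate differences\<close>

definition pairs_at_distance :: "nat \<Rightarrow> nat \<Rightarrow> (nat \<times> nat) set" where
  "pairs_at_distance m i = {(x, x') \<in> {0..m} \<times> {0..m}. nat \<bar>int x' - int x\<bar> = i}"

lemma finite_pairs_at_distance: "finite (pairs_at_distance m i)"
  by (rule finite_subset[of _ "{0..m} \<times> {0..m}"]) (auto simp: pairs_at_distance_def)

lemma card_pairs_at_distance_0: "card (pairs_at_distance m 0) = m + 1"
proof -
  have "pairs_at_distance m 0 = (\<lambda>x. (x, x)) ` {0..m}"
    by (auto simp: pairs_at_distance_def)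
  then show ?thesis by (simp add: card_image inj_on_def)
qed

text \<open>Increasing and decreasing pairs are disjoint for positive \<open>i\<close>, and each is
  fixed by its smaller entry, which ranges over \<open>{0..m - i}\<close>.\<close>

lemma card_pairs_at_distance:
  assumes "1 \<le> i" "i \<le> m"
  shows "card (pairs_at_distance m i) = 2 * (m + 1 - i)"
proof -
  let ?A = "(\<lambda>x. (x, x + i)) ` {0..m - i}" and ?B = "(\<lambda>x. (x + i, x)) ` {0..m - i}"
  have "pairs_at_distance m i = ?A \<union> ?B"
  proof (intro equalityI subsetI)
    fix z assume "z \<in> pairs_at_distance m i"
    then obtain x x' where z: "z = (x, x')" "x \<le> m" "x' \<le> m" "nat \<bar>int x' - int x\<bar> = i"
      by (auto simp: pairs_at_distance_def)
    then consider "x' = x + i" | "x = x' + i" by linarith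
    then show "z \<in> ?A \<union> ?B" using z by cases auto
  qed (use assms in \<open>auto simp: pairs_at_distance_def\<close>)
  moreover have "?A \<inter> ?B = {}" using assms by auto
  moreover have "card ?A = m + 1 - i" "card ?B = m + 1 - i"
    using assms by (simp_all add: card_image inj_on_def)
  ultimately show ?thesis by (simp add: card_Un_disjoint)
qed

text \<open>Primitivity depends only on the absolute coordinate differences. The bijection
  \<open>?h\<close> regroups two points into their pair of first and pair of second coordinates, so
  that each choice of differences contributes a product set.\<close>

lemma card_primitive_pairs_sum:
  "card (primitive_pairs m n) =
    (\<Sum>(i, j) \<in> {(i, j) \<in> {0..m} \<times> {0..n}. gcd i j = 1}.
       card (pairs_at_distance m i) * card (pairs_at_distance n j))"
proof -
  let ?I = "{(i, j) \<in> {0..m} \<times> {0..n}. gcd i j = 1}"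
  let ?P = "\<lambda>(i, j). pairs_at_distance m i \<times> pairs_at_distance n j"
  let ?h = "\<lambda>((x, x'), (y, y')). ((x, y), (x', y')) :: (nat \<times> nat) \<times> (nat \<times> nat)"
  define dist where "dist x x' = nat \<bar>int x' - int x\<bar>" for x x' :: nat
  have prim: "primitive (vec (x, y) (x', y')) \<longleftrightarrow> gcd (dist x x') (dist y y') = 1" for x y x' y'
  proof -
    have "gcd (int x' - int x) (int y' - int y) = int (gcd (dist x x') (dist y y'))"
      unfolding dist_def by (rule gcd_int_def)
    then show ?thesis
      unfolding primitive_def vec_def coprime_iff_gcd_eq_1 fst_conv snd_conv by linarith
  qed
  have pad: "pairs_at_distance k i = {(x, x'). x \<le> k \<and> x' \<le> k \<and> dist x x' = i}" for k i
    by (auto simp: pairs_at_distance_def dist_def)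
  have le: "dist x x' \<le> k" if "x \<le> k" "x' \<le> k" for x x' k
    using that by (auto simp: dist_def)
  have mem: "((x, y), (x', y')) \<in> primitive_pairs m n \<longleftrightarrow> ((x, x'), (y, y')) \<in> (\<Union>z\<in>?I. ?P z)"
    for x y x' y'
    by (auto simp: primitive_pairs_def grid_def pad prim le)
  have inj: "inj ?h" by (auto simp: inj_def)
  have "primitive_pairs m n = ?h ` (\<Union>z\<in>?I. ?P z)"
  proof (rule set_eqI)
    fix w :: "(nat \<times> nat) \<times> (nat \<times> nat)"
    obtain x y x' y' where w: "w = ((x, y), (x', y'))" by (metis prod.exhaust)
    then have "w = ?h ((x, x'), (y, y'))" by simp
    then have "w \<in> ?h ` (\<Union>z\<in>?I. ?P z) \<longleftrightarrow> ((x, x'), (y, y')) \<in> (\<Union>z\<in>?I. ?P z)"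
      by (simp only: inj_image_mem_iff[OF inj])
    then show "w \<in> primitive_pairs m n \<longleftrightarrow> w \<in> ?h ` (\<Union>z\<in>?I. ?P z)"
      by (simp only: w mem)
  qed
  then have "card (primitive_pairs m n) = card (\<Union>z\<in>?I. ?P z)"
    by (simp only: card_image[OF inj_on_subset[OF inj subset_UNIV]])
  also have "\<dots> = (\<Sum>z\<in>?I. card (?P z))"
  proof (rule card_UN_disjoint)
    show "finite ?I" by (rule finite_subset[of _ "{0..m} \<times> {0..n}"]) auto
    show "\<forall>z\<in>?I. finite (?P z)" by (auto simp: finite_pairs_at_distance)
    show "\<forall>z\<in>?I. \<forall>z'\<in>?I. z \<noteq> z' \<longrightarrow> ?P z \<inter> ?P z' = {}" by (auto simp: pad)
  qed
  also have "\<dots> = (\<Sum>(i, j)\<in>?I. card (pairs_at_distance m i) * card (pairs_at_distance n j))"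
    by (intro sum.cong) (auto simp: card_cartesian_product)
  finally show ?thesis .
qed

text \<open>On the axes only \<open>(0, 1)\<close> and \<open>(1, 0)\<close> have gcd 1, and they
  lie in range since \<open>m\<close> and \<open>n\<close> are positive; they yield the first two
  summands. Elsewhere each coordinate contributes a factor 2 for its sign, hence
  \<open>4 * V m n\<close>.\<close>

lemma card_primitive_pairs:
  assumes "m > 0" "n > 0"
  shows "card (primitive_pairs m n) = 2 * n * (m + 1) + 2 * m * (n + 1) + 4 * V m n"
proof -
  let ?c = "\<lambda>(i, j). card (pairs_at_distance m i) * card (pairs_at_distance n j)"
  let ?J = "{(i, j). 1 \<le> i \<and> i \<le> m \<and> 1 \<le> j \<and> j \<le> n \<and> gcd i j = 1}"
  have "{(i, j) \<in> {0..m} \<times> {0..n}. gcd i j = 1} = {(0, 1), (1, 0)} \<union> ?J"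
    using assms by (auto simp: Suc_le_eq) (metis gcd_0_left_nat gcd_0_nat gr0I)+
  moreover have "finite ?J" by (rule finite_subset[of _ "{0..m} \<times> {0..n}"]) auto
  moreover have "{(0, 1), (1, 0)} \<inter> ?J = {}" by auto
  ultimately have "card (primitive_pairs m n) = sum ?c {(0, 1), (1, 0)} + sum ?c ?J"
    by (simp only: card_primitive_pairs_sum) (intro sum.union_disjoint; simp)
  moreover have "sum ?c {(0, 1), (1, 0)} = 2 * n * (m + 1) + 2 * m * (n + 1)"
    using assms by (simp add: card_pairs_at_distance_0 card_pairs_at_distance)
  moreover have "sum ?c ?J = 4 * V m n"
    unfolding V_def sum_distrib_left
    by (intro sum.cong) (auto simp: card_pairs_at_distance)
  ultimately show ?thesis by simp
qed

theorem theorem3: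
  fixes m n :: nat
  assumes "m > 0" and "n > 0"
  shows "N m n = (2 * m + 1) * (2 * n + 1) + 1 + 4 * V m n"
  \<comment> \<open>The axis terms and the two constants add up to
    \<open>4 * m * n + 2 * m + 2 * n + 2\<close>, which is
    \<open>(2 * m + 1) * (2 * n + 1) + 1\<close>.\<close>
  unfolding N_eq_card_primitive_pairs card_primitive_pairs[OF assms]
  by (simp add: algebra_simps)

end
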